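(* For any prime power $q$, and any $b,c\in\mathbb{F}_{q^2}$, the polynomial $f(X):=X^{q+2}+bX^q+cX$ permutes $\mathbb{F}_{q^2}$ if and only if one of the following holds: (1) $q\not\equiv 1\pmod 3$, $b=0$, and $c^{q-1}$ is a root of $X^3-X^2+X$; (2) $q=2$, $b\ne 0$, and $c=1$. *)

theory Defs
  imports "HOL-Computational_Algebra.Primes" "HOL-Library.Cardinality"
begin

end

theory Submission
  imports Defs "HOL-Computational_Algebra.Polynomial"
begin

text \<open>
  Write \<open>conj x = x ^ q\<close>, so that \<open>f x = x\<^sup>2 conj x + b conj x + c x\<close>. If \<open>f\<close> permutes the field, then
  the sum of \<open>f x ^ i * conj (f x) ^ j\<close> over all \<open>x\<close> vanishes for \<open>0 < i + q j < q\<^sup>2 - 1\<close>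
  (Hermite's criterion). For \<open>i\<close>, \<open>j\<close> near \<open>q / 3\<close>, the only monomial
  contributing to this sum is \<open>x ^ (q - 1) * conj x ^ (q - 1)\<close>, and it lies so close to the top degree
  that its coefficient has only a few terms. The choice \<open>i = j = (q - 1) / 3\<close> excludes
  \<open>q mod 3 = 1\<close>; otherwise, for \<open>q > 2\<close>, suitable \<open>i\<close>, \<open>j\<close> give \<open>b = 0\<close> and, away from characteristic \<open>3\<close>, the
  equation \<open>c\<^sup>2 - c conj c + (conj c)\<^sup>2 = 0\<close>.

  If \<open>b = 0\<close>, then \<open>f x = x * (x * conj x + c)\<close>, so \<open>f\<close> acts on norms by the cubic
  \<open>t (t + c) (t + conj c)\<close> over the subfield of order \<open>q\<close>. Under the above equation this is an affine
  image of a cube, or additive with trivial kernel in characteristic \<open>3\<close>. In characteristic \<open>3\<close> a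
  nonzero trace of \<open>c\<close> leads to an explicit collision of the cubic.
\<close>

section \<open>Power sums over a finite field\<close>

text \<open>Multiplication by \<open>x\<close> permutes the nonzero elements, so their product
  absorbs the factor \<open>x ^ (CARD('a) - 1)\<close>.\<close>

lemma finite_field_power_card_minus_1:
  fixes x :: "'a::{field, finite}"
  assumes "x \<noteq> 0"
  shows "x ^ (CARD('a) - 1) = 1"
proof -
  have "(\<Prod>y\<in>UNIV-{0}. y) = (\<Prod>y\<in>UNIV-{0}. x * y)"
    by (rule prod.reindex_bij_witness[of _ "\<lambda>y. x * y" "\<lambda>y. y / x"]) (use assms in auto)
  also have "\<dots> = x ^ (CARD('a) - 1) * (\<Prod>y\<in>UNIV-{0}. y)"
    by (simp add: prod.distrib)
  finally show ?thesis
    by simp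
qed

lemma of_nat_CARD_eq_0: "of_nat CARD('a::{ring_1, finite}) = (0 :: 'a)"
proof -
  have "(\<Sum>x\<in>UNIV. x) = (\<Sum>x\<in>UNIV. x + 1 :: 'a)"
    by (rule sum.reindex_bij_witness[of _ "\<lambda>x. x + 1" "\<lambda>x. x - 1"]) auto
  thus ?thesis
    by (simp add: sum.distrib)
qed

lemma card_nth_roots_le:
  fixes a :: "'a::idom"
  assumes "n > 0"
  shows "card {x. x ^ n = a} \<le> n"
proof -
  let ?P = "monom 1 n - [:a:]"
  have "degree ?P = n"
    using assms by (subst diff_conv_add_uminus, subst degree_add_eq_left) (auto simp: degree_monom_eq)
  moreover from this have "?P \<noteq> 0"
    using assms by auto
  ultimately have "card {x. poly ?P x = 0} \<le> n"
    using card_poly_roots_bound[of ?P] by simp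
  thus ?thesis
    by (simp add: poly_monom)
qed

text \<open>Scaling the summation variable by \<open>y\<close> multiplies the sum by
  \<open>y ^ m\<close>. Some nonzero \<open>y\<close> has \<open>y ^ m \<noteq> 1\<close>, because
  with \<open>l = m mod (CARD('a) - 1)\<close> the equation \<open>y ^ l = 1\<close> has at most
  \<open>l\<close> solutions.\<close>

lemma sum_power_UNIV_eq_0:
  fixes m :: nat
  assumes "\<not> (CARD('a::{field, finite}) - 1) dvd m"
  shows "(\<Sum>x\<in>UNIV. (x::'a) ^ m) = 0"
proof -
  let ?N = "CARD('a) - 1"
  define l where "l = m mod ?N"
  have N: "?N > 0"
    using assms card_2_iff[of "{0, 1 :: 'a}"] card_mono[of UNIV "{0, 1 :: 'a}"] by simp
  have l: "0 < l" "l < ?N"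
    using assms N by (auto simp: l_def dvd_eq_mod_eq_0)
  obtain y :: 'a where y: "y \<noteq> 0" "y ^ l \<noteq> 1"
  proof (rule ccontr)
    assume "\<not> thesis"
    hence "UNIV - {0} \<subseteq> {y :: 'a. y ^ l = 1}"
      using that by auto
    hence "?N \<le> card {y :: 'a. y ^ l = 1}"
      using card_mono[of "{y :: 'a. y ^ l = 1}" "UNIV - {0}"] by simp
    with card_nth_roots_le[OF l(1), of "1 :: 'a"] l(2) show False
      by simp
  qed
  have "y ^ m = y ^ (?N * (m div ?N) + l)"
    by (simp add: l_def)
  also have "\<dots> = y ^ l"
    using finite_field_power_card_minus_1[OF y(1)] by (simp add: power_add power_mult)
  finally have ym: "y ^ m \<noteq> 1"
    using y(2) by simp
  have "(\<Sum>x\<in>UNIV. x ^ m) = (\<Sum>x\<in>UNIV. (y * x) ^ m)"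
    by (rule sum.reindex_bij_witness[of _ "\<lambda>x. y * x" "\<lambda>x. x / y"]) (use y in auto)
  also have "\<dots> = y ^ m * (\<Sum>x\<in>UNIV. x ^ m)"
    by (simp add: power_mult_distrib sum_distrib_left)
  finally show ?thesis
    using ym by simp
qed

lemma sum_power_UNIV_eq_minus_1:
  fixes m :: nat
  assumes "(CARD('a::{field, finite}) - 1) dvd m" "m > 0"
  shows "(\<Sum>x\<in>UNIV. (x::'a) ^ m) = -1"
proof -
  have "(\<Sum>x\<in>UNIV. (x::'a) ^ m) = (\<Sum>x\<in>UNIV-{0}. (x::'a) ^ m)"
    by (rule sum.mono_neutral_right) (use assms in auto)
  also have "\<dots> = (\<Sum>x\<in>UNIV-{0::'a}. 1)"
    using assms(1)
    by (intro sum.cong)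
       (auto elim!: dvdE simp: power_mult finite_field_power_card_minus_1[unfolded One_nat_def])
  also have "\<dots> = of_nat (CARD('a) - 1)"
    by simp
  also have "\<dots> = -1"
    by (simp add: of_nat_diff of_nat_CARD_eq_0)
  finally show ?thesis .
qed

text \<open>A range independent of \<open>n\<close> makes the summations of nested expansions
  interchangeable; the added binomial coefficients are zero.\<close>

lemma binomial_ring_atMost:
  fixes a b :: "'a::comm_semiring_1"
  assumes "n \<le> M"
  shows "(a + b) ^ n = (\<Sum>k\<le>M. of_nat (n choose k) * a ^ k * b ^ (n - k))"
  unfolding binomial_ring using assms by (intro sum.mono_neutral_left) (auto simp: binomial_eq_0)

section \<open>The quadratic extension and its conjugation\<close>

locale permutation_trinomial =
  fixes p e q :: nat and b c :: "'a::{field, finite}"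
  assumes prime_p: "prime p" and e_pos: "e \<ge> 1" and q_def: "q = p ^ e"
    and card_q: "CARD('a) = q ^ 2"
begin

abbreviation conj :: "'a \<Rightarrow> 'a" where "conj x \<equiv> x ^ q"

definition f :: "'a \<Rightarrow> 'a" where "f x = x ^ (q + 2) + b * x ^ q + c * x"

lemma q_ge_2: "q \<ge> 2"
  using prime_ge_2_nat[OF prime_p] e_pos self_le_power[of p e] by (simp add: q_def)

lemma of_nat_p: "of_nat p = (0 :: 'a)"
  using of_nat_CARD_eq_0[where 'a = 'a] e_pos by (simp add: card_q q_def)

lemma of_nat_q: "of_nat q = (0 :: 'a)"
  using of_nat_p e_pos by (simp add: q_def)

lemma CHAR_eq: "CHAR('a) = p"
  using of_nat_p prime_p by (metis CHAR_not_1' One_nat_def of_nat_eq_0_iff_char_dvd prime_nat_iff)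

lemma of_nat_eq_0_iff: "of_nat n = (0 :: 'a) \<longleftrightarrow> p dvd n"
  using of_nat_eq_0_iff_char_dvd[where 'a = 'a] CHAR_eq by simp

lemma conj_add: "conj (x + y) = conj x + conj y"
  by (rule freshmans_dream'[of _ e]) (use CHAR_eq prime_p q_def in auto)

lemma conj_0: "conj 0 = 0"
  using q_ge_2 by simp

lemma conj_diff: "conj (x - y) = conj x - conj y"
  using conj_add[of "x - y" y] by (simp add: eq_diff_eq)

lemma conj_mult: "conj (x * y) = conj x * conj y"
  by (rule power_mult_distrib)

lemma conj_conj: "conj (conj x) = x"
proof (cases "x = 0")
  case False
  have "conj (conj x) = x ^ (q ^ 2)"
    by (simp only: power2_eq_square power_mult)
  also have "q ^ 2 = Suc (q ^ 2 - 1)"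
    using q_ge_2 by simp
  also have "x ^ \<dots> = x * x ^ (CARD('a) - 1)"
    by (simp only: card_q power_Suc)
  finally show ?thesis
    using finite_field_power_card_minus_1[OF False] by simp
qed (use q_ge_2 in auto)

lemma conj_power: "conj (x ^ n) = conj x ^ n"
  by (metis power_commutes power_mult mult.commute)

lemma f_eq: "f x = (b * conj x + c * x) + x ^ 2 * conj x"
  by (simp add: f_def power_add power2_eq_square mult_ac)

lemma conj_f: "conj (f x) = (conj b * x + conj c * conj x) + conj x ^ 2 * x"
  by (simp only: f_eq conj_add conj_mult conj_conj conj_power[of _ 2])

section \<open>Hermite's criterion and coefficient extraction\<close>

text \<open>The summand is \<open>x ^ (a + q * l)\<close>. The bounds on \<open>a + l\<close> rule
  out the exponents \<open>0\<close> and \<open>2 * (q ^ 2 - 1)\<close>, so only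
  \<open>q ^ 2 - 1\<close> itself remains as a relevant multiple, and it is attained only at
  \<open>a = l = q - 1\<close>.\<close>

lemma sum_monomial:
  assumes "a \<le> 2 * q - 2" "l \<le> 2 * q - 2" "a + l > 0" "a + l < 4 * q - 4"
  shows "(\<Sum>x\<in>UNIV. x ^ a * conj x ^ l) = (if a = q - 1 \<and> l = q - 1 then -1 else 0)"
proof -
  obtain r where r: "q = r + 2"
    using q_ge_2 le_Suc_ex by (metis add.commute)
  have N: "CARD('a) - 1 = (r + 1) * (r + 3)"
    by (simp add: card_q r power2_eq_square algebra_simps)
  have dvd: "(CARD('a) - 1) dvd a + q * l \<longleftrightarrow> a = q - 1 \<and> l = q - 1"
  proof
    assume "(CARD('a) - 1) dvd a + q * l"
    then obtain t where t: "a + q * l = (CARD('a) - 1) * t"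
      by (auto elim: dvdE)
    have t': "a + (r + 2) * l = (r + 1) * (r + 3) * t"
      using t by (simp only: N r)
    have ub: "a + (r + 2) * l < (r + 1) * (r + 3) * 2"
    proof -
      have "a + (r + 2) * l = (a + l) + (r + 1) * l"
        by (simp add: algebra_simps)
      also have "(r + 1) * l \<le> (r + 1) * (2 * r + 2)"
        using assms(2) by (intro mult_left_mono) (auto simp: r)
      also have "a + l < 4 * r + 4"
        using assms(4) by (simp add: r)
      finally show ?thesis
        by (simp add: algebra_simps)
    qed
    have "t < 2"
      using ub unfolding t' by (simp only: mult_less_cancel1)
    moreover have "t \<noteq> 0"
      using t' assms(3) by (intro notI) simp
    ultimately have "t = 1"
      by simp
    with t' have *: "a + (r + 2) * l = (r + 1) * (r + 3)"
      by simp
    \<comment> \<open>In terms of \<open>q\<close>, this gives \<open>a = (q - 1) + q * z\<close>;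
      since \<open>a\<close> lies between \<open>0\<close> and \<open>2 * (q - 1)\<close>,
      \<open>z\<close> must vanish.\<close>
    define z where "z = int r + 1 - int l"
    have az: "int a = (int r + 1) + (int r + 2) * z"
    proof -
      have "int (a + (r + 2) * l) = int ((r + 1) * (r + 3))"
        using * by simp
      thus ?thesis
        by (simp add: z_def algebra_simps)
    qed
    have a: "int a \<le> 2 * int r + 2" "int a \<ge> 0"
      using assms(1) by (auto simp: r)
    define y where "y = (int r + 2) * z"
    have "z < 1"
    proof (rule ccontr)
      assume "\<not> z < 1"
      hence "(int r + 2) * 1 \<le> y"
        unfolding y_def by (intro mult_left_mono) auto
      with az a show False
        unfolding y_def[symmetric] by simp
    qed
    moreover have "z > -1"
    proof (rule ccontr)
      assume "\<not> z > -1"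
      hence "y \<le> (int r + 2) * (-1)"
        unfolding y_def by (intro mult_left_mono) auto
      with az a show False
        unfolding y_def[symmetric] by simp
    qed
    ultimately have "z = 0"
      by simp
    hence "l = r + 1"
      by (simp add: z_def)
    thus "a = q - 1 \<and> l = q - 1"
      using * by (simp add: r algebra_simps)
  next
    assume "a = q - 1 \<and> l = q - 1"
    thus "(CARD('a) - 1) dvd a + q * l"
      unfolding N by (intro dvdI[of _ _ 1]) (simp add: r algebra_simps)
  qed
  have "(\<Sum>x\<in>UNIV. x ^ a * conj x ^ l) = (\<Sum>x\<in>(UNIV::'a set). x ^ (a + q * l))"
    by (simp add: power_add power_mult)
  thus ?thesis
    using sum_power_UNIV_eq_0[where 'a = 'a, of "a + q * l"] assms(3) q_ge_2
      sum_power_UNIV_eq_minus_1[where 'a = 'a, of "a + q * l"] dvd by auto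
qed

text \<open>A bijection only reorders the sum, which leaves a monomial sum whose exponents are not
  both \<open>q - 1\<close>.\<close>

lemma sum_power_f_eq_0:
  assumes "bij f" "i < q" "j < q" "i + j > 0" "i + j < 2 * q - 2"
  shows "(\<Sum>x\<in>UNIV. f x ^ i * conj (f x) ^ j) = 0"
proof -
  have "(\<Sum>x\<in>UNIV. f x ^ i * conj (f x) ^ j) = (\<Sum>x\<in>UNIV. x ^ i * conj x ^ j)"
    using assms(1) by (rule sum.reindex_bij_betw)
  also have "\<dots> = 0"
  proof (cases "i = q - 1 \<and> j = q - 1")
    case False
    thus ?thesis
      using assms q_ge_2 by (subst sum_monomial) auto
  qed (use assms in auto)
  finally show ?thesis .
qed

text \<open>
  Coefficient of the term of \<open>f x ^ i * conj (f x) ^ j\<close> in which \<open>r\<close> factors \<open>f x\<close> and \<open>s\<close> factors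
  \<open>conj (f x)\<close> avoid their cubic summand, \<open>u\<close> resp. \<open>v\<close> of them contributing \<open>b\<close> resp. \<open>conj b\<close>.
\<close>

definition term_coeff :: "nat \<Rightarrow> nat \<Rightarrow> nat \<Rightarrow> nat \<Rightarrow> nat \<Rightarrow> nat \<Rightarrow> 'a" where
  "term_coeff i j r s u v = of_nat ((i choose r) * (j choose s) * (r choose u) * (s choose v)) *
     b ^ u * c ^ (r - u) * conj b ^ v * conj c ^ (s - v)"

lemma power_f_expand:
  assumes "i \<le> M" "j \<le> M"
  shows "f x ^ i * conj (f x) ^ j = (\<Sum>r\<le>M. \<Sum>s\<le>M. \<Sum>v\<le>M. \<Sum>u\<le>M. term_coeff i j r s u v *
     (x ^ (2 * (i - r) + (r - u) + (j - s) + v) * conj x ^ ((i - r) + u + 2 * (j - s) + (s - v))))"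
proof -
  define y where "y = conj x"
  have 1: "f x ^ i = (\<Sum>r\<le>M. \<Sum>u\<le>M. of_nat (i choose r) *
      (of_nat (r choose u) * (b * y) ^ u * (c * x) ^ (r - u)) * (x ^ 2 * y) ^ (i - r))"
    unfolding f_eq y_def[symmetric] binomial_ring_atMost[OF assms(1)]
  proof (rule sum.cong[OF refl], goal_cases)
    case (1 r)
    thus ?case
      by (simp add: binomial_ring_atMost[of r M] sum_distrib_left sum_distrib_right)
  qed
  have 2: "conj (f x) ^ j = (\<Sum>s\<le>M. \<Sum>v\<le>M. of_nat (j choose s) *
      (of_nat (s choose v) * (conj b * x) ^ v * (conj c * y) ^ (s - v)) * (y ^ 2 * x) ^ (j - s))"
    unfolding conj_f y_def[symmetric] binomial_ring_atMost[OF assms(2)]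
  proof (rule sum.cong[OF refl], goal_cases)
    case (1 s)
    thus ?case
      by (simp add: binomial_ring_atMost[of s M] sum_distrib_left sum_distrib_right)
  qed
  show ?thesis
    unfolding 1 2 y_def[symmetric] sum_product
  proof (rule sum.cong[OF refl], rule sum.cong[OF refl], subst sum.swap,
      rule sum.cong[OF refl], rule sum.cong[OF refl], goal_cases)
    case (1 r s v u)
    show ?case
      by (simp only: term_coeff_def power_mult_distrib power_add power_mult power2_eq_square of_nat_mult mult_ac)
  qed
qed

text \<open>
  The terms contributing to \<open>x ^ (q - 1) * conj x ^ (q - 1)\<close> are those with \<open>r + s = R\<close> and \<open>u = v + d\<close>.
\<close>

lemma coefficient_eq_0:
  assumes "bij f" and deg: "3 * (i + j) = 2 * (q - 1) + 2 * R" and ij: "i = j + 2 * d"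
    and bound: "2 * i + j \<le> 2 * q - 2" and R: "R < q - 1"
  shows "(\<Sum>r\<le>R. \<Sum>v\<le>R. term_coeff i j r (R - r) (v + d) v) = 0"
proof -
  define Q where "Q = q - 1"
  have Q: "q - 1 = Q" "2 * q - 2 = 2 * Q" "4 * q - 4 = 4 * Q" "q = Suc Q" "Q > 0"
    using q_ge_2 by (auto simp: Q_def)
  note assms' = assms(2-5)[unfolded Q(1-3)]
  define M where "M = i + R"
  have ijM: "i \<le> M" "j \<le> M"
    using ij by (auto simp: M_def)
  \<comment> \<open>The two exponents add up to \<open>3 * (i + j) - 2 * (r + s)\<close> and differ
    by \<open>2 * d - 2 * (u - v)\<close>. Hence both equal \<open>q - 1\<close> exactly if
    \<open>r + s = R\<close> and \<open>u = v + d\<close>. The assumptions \<open>bound\<close> and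
    \<open>R\<close> keep them in the range of \<open>sum_monomial\<close>.\<close>
  have mono: "term_coeff i j r s u v * (\<Sum>x\<in>UNIV. x ^ (2 * (i - r) + (r - u) + (j - s) + v) *
      conj x ^ ((i - r) + u + 2 * (j - s) + (s - v))) =
      (if u = v + d then if s = R - r \<and> r \<le> R then - term_coeff i j r s (v + d) v else 0 else 0)" for r s u v
  proof (cases "r \<le> i \<and> s \<le> j \<and> u \<le> r \<and> v \<le> s")
    case True
    let ?a = "2 * (i - r) + (r - u) + (j - s) + v"
    let ?e = "(i - r) + u + 2 * (j - s) + (s - v)"
    obtain i' j' r' s' where *: "i = r + i'" "j = s + j'" "r = u + r'" "s = v + s'"
      using True by (meson le_iff_add)
    have a: "?a = 2 * i' + r' + j' + v" and e: "?e = i' + u + 2 * j' + s'"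
      by (simp_all add: *)
    have n: "3 * (u + r' + i' + v + s' + j') = 2 * Q + 2 * R" "u + r' + i' = v + s' + j' + 2 * d"
      "2 * (u + r' + i') + (v + s' + j') \<le> 2 * Q" "R < Q"
      using assms' by (simp_all add: *)
    have "?a = q - 1 \<and> ?e = q - 1 \<longleftrightarrow> u = v + d \<and> r + s = R"
    proof -
      have rs: "r + s = u + r' + v + s'"
        by (simp add: *)
      show ?thesis
        unfolding a e Q(1) rs using n(1,2) by auto
    qed
    also have "r + s = R \<longleftrightarrow> s = R - r \<and> r \<le> R"
      by auto
    finally have "?a = q - 1 \<and> ?e = q - 1 \<longleftrightarrow> u = v + d \<and> s = R - r \<and> r \<le> R" .
    moreover have "?a \<le> 2 * q - 2"
      unfolding a Q(1-3) using n by simp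
    moreover have "?e \<le> 2 * q - 2"
      unfolding e Q(1-3) using n by simp
    moreover have "?a + ?e > 0"
      unfolding a e by (rule ccontr) (use n in auto)
    moreover have "?a + ?e < 4 * q - 4"
      unfolding a e Q(1-3) using n by simp
    ultimately show ?thesis
      by (subst sum_monomial) auto
  next
    case False
    hence "term_coeff i j r s u v = 0"
      by (auto simp: term_coeff_def binomial_eq_0)
    thus ?thesis
      by auto
  qed
  have "i < q" "j < q" "i + j > 0" "i + j < 2 * q - 2"
    unfolding Q using assms' by auto
  hence "0 = (\<Sum>x\<in>UNIV. f x ^ i * conj (f x) ^ j)"
    using assms(1) by (simp add: sum_power_f_eq_0)
  also have "\<dots> = (\<Sum>r\<le>M. \<Sum>s\<le>M. \<Sum>v\<le>M. \<Sum>u\<le>M. term_coeff i j r s u v *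
     (\<Sum>x\<in>UNIV. x ^ (2 * (i - r) + (r - u) + (j - s) + v) *
      conj x ^ ((i - r) + u + 2 * (j - s) + (s - v))))"
    unfolding power_f_expand[OF ijM] sum_distrib_left
    by (subst sum.swap, rule sum.cong[OF refl])+ (rule refl)
  also have "\<dots> = (\<Sum>r\<le>M. \<Sum>s\<le>M. \<Sum>v\<le>M.
      if s = R - r \<and> r \<le> R then - term_coeff i j r s (v + d) v else 0)"
  proof (unfold mono, intro sum.cong refl, goal_cases)
    case (1 r s v)
    \<comment> \<open>The index \<open>u = v + d\<close> may leave the summation range, but then
      \<open>r choose (v + d)\<close> is zero.\<close>
    have "term_coeff i j r s (v + d) v = 0" if "v + d > M"
      using that 1 by (simp add: term_coeff_def binomial_eq_0)
    thus ?case
      by auto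
  qed
  also have "\<dots> = (\<Sum>r\<le>M. \<Sum>v\<le>M. if r \<le> R then - term_coeff i j r (R - r) (v + d) v else 0)"
  proof (rule sum.cong[OF refl], goal_cases)
    case (1 r)
    have "(\<Sum>s\<le>M. \<Sum>v\<le>M. if s = R - r \<and> r \<le> R then - term_coeff i j r s (v + d) v else 0) =
      (\<Sum>s\<le>M. if s = R - r then (\<Sum>v\<le>M. if r \<le> R then - term_coeff i j r s (v + d) v else 0) else 0)"
      by (intro sum.cong) auto
    also have "\<dots> = (\<Sum>v\<le>M. if r \<le> R then - term_coeff i j r (R - r) (v + d) v else 0)"
      by (simp add: M_def)
    finally show ?case .
  qed
  also have "\<dots> = (\<Sum>r\<le>R. \<Sum>v\<le>M. if r \<le> R then - term_coeff i j r (R - r) (v + d) v else 0)"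
    by (intro sum.mono_neutral_right) (auto simp: M_def)
  also have "\<dots> = (\<Sum>r\<le>R. \<Sum>v\<le>R. - term_coeff i j r (R - r) (v + d) v)"
  proof (rule sum.cong[OF refl], goal_cases)
    case (1 r)
    have "(\<Sum>v\<le>M. - term_coeff i j r (R - r) (v + d) v) = (\<Sum>v\<le>R. - term_coeff i j r (R - r) (v + d) v)"
      by (intro sum.mono_neutral_right) (auto simp: M_def term_coeff_def binomial_eq_0)
    thus ?case
      using 1 by simp
  qed
  finally show ?thesis
    by (simp add: sum_negf)
qed

section \<open>Necessary conditions from vanishing coefficients\<close>

text \<open>For \<open>i = j = (q - 1) / 3\<close> one has \<open>R = 0\<close>: only the product of
  the cubic summands contributes, with coefficient \<open>1\<close>.\<close>

lemma not_bij_if_mod_3_eq_1: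
  assumes "q mod 3 = 1"
  shows "\<not> bij f"
proof
  assume bij: "bij f"
  define k where "k = q div 3"
  have q: "q = 3 * k + 1"
    using assms by (simp add: k_def) presburger
  have "(\<Sum>r\<le>0. \<Sum>v\<le>0. term_coeff k k r (0 - r) (v + 0) v) = 0"
    using bij q q_ge_2 by (intro coefficient_eq_0) auto
  thus False
    by (simp add: term_coeff_def)
qed

text \<open>For \<open>i = q / 3 + 1\<close>, \<open>j = q / 3 - 1\<close> and
  \<open>R = d = 1\<close>, the only surviving term is \<open>i * b\<close>, and \<open>i\<close> is
  prime to \<open>3\<close>.\<close>

lemma b_eq_0_if_p_eq_3:
  assumes "bij f" "p = 3"
  shows "b = 0"
proof -
  define k where "k = 3 ^ (e - 1) - (1 :: nat)"
  have q: "q = 3 * k + 3"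
    using e_pos assms(2) by (cases e) (simp_all add: k_def q_def algebra_simps)
  have "\<not> 3 dvd k + 2"
  proof (cases "e = 1")
    case False
    hence "(3::nat) dvd 3 ^ (e - 1)"
      using e_pos by (intro dvd_power) auto
    moreover have "k + 2 = 3 ^ (e - 1) + 1"
      by (simp add: k_def)
    ultimately show ?thesis
      by presburger
  qed (simp add: k_def numeral_2_eq_2[symmetric])
  hence "of_nat (k + 2) \<noteq> (0 :: 'a)"
    unfolding of_nat_eq_0_iff assms(2) .
  moreover have "(\<Sum>r\<le>1. \<Sum>v\<le>1. term_coeff (k + 2) k r (1 - r) (v + 1) v) = 0"
    using assms(1) q by (intro coefficient_eq_0) auto
  hence "of_nat (k + 2) * b = 0"
    by (simp add: term_coeff_def)
  ultimately show ?thesis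
    by simp
qed

text \<open>Taken from \<open>i = j = (q + 1) / 3\<close>, \<open>R = 2\<close>,
  \<open>d = 0\<close>; \<open>k > 0\<close> secures \<open>R < q - 1\<close>. The relation has
  coefficients \<open>B ^ 2\<close> and \<open>A\<close>, which become \<open>1\<close> and
  \<open>-1\<close> after multiplication by \<open>9\<close>.\<close>

lemma norm_relation:
  assumes "bij f" and q: "q = 3 * k + 2" and "k > 0"
  shows "b * conj b + c * conj c = c ^ 2 + conj c ^ 2"
proof -
  define A B :: 'a where "A = of_nat ((k + 1) choose 2)" and "B = of_nat (k + 1)"
  have B: "3 * B = 1"
    using of_nat_q unfolding q B_def by (simp add: algebra_simps)
  \<comment> \<open>In odd characteristic this follows from \<open>2 * A = B * (B - 1)\<close>. In
    characteristic \<open>2\<close> that identity is void, so the parity of the binomial coefficient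
    is computed from \<open>k mod 4 = 2\<close>.\<close>
  have A: "9 * A = -1"
  proof (cases "p = 2")
    case True
    have "e \<noteq> 1"
      using q assms(3) True by (auto simp: q_def)
    hence "(4::nat) dvd q"
      using True e_pos le_imp_power_dvd[of 2 e "2::nat"] by (simp add: q_def)
    then obtain m where m: "k = 4 * m + 2"
      using q by (intro that[of "k div 4"]) presburger
    have "(k + 1) choose 2 = (4 * m + 3) * (2 * m + 1)"
      by (simp add: choose_two m algebra_simps)
    hence "even (9 * ((k + 1) choose 2) + 1)"
      by simp
    hence "of_nat (9 * ((k + 1) choose 2) + 1) = (0 :: 'a)"
      unfolding of_nat_eq_0_iff True .
    thus ?thesis
      by (simp add: A_def eq_neg_iff_add_eq_0 add.commute)
  next
    case False
    have "2 * ((k + 1) choose 2) = (k + 1) * k"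
      by (simp add: choose_two)
    hence "2 * A = B * (B - 1)"
      unfolding A_def B_def by (metis add_diff_cancel_right' of_nat_1 of_nat_add of_nat_mult of_nat_numeral)
    hence "9 * (2 * A) = 9 * (B * (B - 1))"
      by (rule arg_cong)
    hence "2 * (9 * A) = (3 * B) * (3 * B - 3)"
      by (simp add: algebra_simps)
    hence "2 * (9 * A + 1) = 0"
      unfolding B by simp
    moreover have "(2 :: 'a) \<noteq> 0"
      using of_nat_eq_0_iff[of 2] False prime_p primes_dvd_imp_eq[of p 2] by auto
    ultimately show ?thesis
      unfolding mult_eq_0_iff by (simp add: eq_neg_iff_add_eq_0)
  qed
  have "(\<Sum>r\<le>2. \<Sum>v\<le>2. term_coeff (k + 1) (k + 1) r (2 - r) (v + 0) v) = 0"
    using assms by (intro coefficient_eq_0) auto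
  hence "B ^ 2 * (b * conj b + c * conj c) + A * (c ^ 2 + conj c ^ 2) = 0"
    by (simp add: term_coeff_def A_def B_def numeral_2_eq_2 algebra_simps)
  hence "9 * (B ^ 2 * (b * conj b + c * conj c) + A * (c ^ 2 + conj c ^ 2)) = 0"
    by simp
  hence "(3 * B) ^ 2 * (b * conj b + c * conj c) + (9 * A) * (c ^ 2 + conj c ^ 2) = 0"
    by (simp add: algebra_simps power2_eq_square)
  hence "(b * conj b + c * conj c) - (c ^ 2 + conj c ^ 2) = 0"
    unfolding A B by (simp only: power_one mult_1_left mult_minus1 add_uminus_conv_diff)
  thus ?thesis
    by (simp only: right_minus_eq)
qed

text \<open>The choice \<open>i = k + 2\<close>, \<open>j = k\<close>, \<open>R = 2\<close>,
  \<open>d = 1\<close> yields \<open>b * (c - 2 * conj c) = 0\<close>. If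
  \<open>b \<noteq> 0\<close>, conjugating \<open>c = 2 * conj c\<close> gives
  \<open>3 * c = 0\<close>, so \<open>c = 0\<close>, and \<open>norm_relation\<close> forces
  \<open>b = 0\<close>.\<close>

lemma b_eq_0_if_p_odd:
  assumes "bij f" and q: "q = 3 * k + 2" and "p \<noteq> 2"
  shows "b = 0"
proof (rule ccontr)
  assume b: "b \<noteq> 0"
  have k: "k > 0"
  proof (rule ccontr)
    assume "\<not> k > 0"
    hence "p ^ e = 2"
      using q by (simp add: q_def)
    hence "p dvd 2"
      using e_pos by (metis dvd_power less_le_trans zero_less_one)
    thus False
      using assms(3) prime_p primes_dvd_imp_eq[of p 2] by auto
  qed
  have "p \<noteq> 3"
  proof
    assume "p = 3"
    hence "3 dvd q"
      using e_pos by (simp add: q_def dvd_power)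
    thus False
      unfolding q by presburger
  qed
  hence two: "(2 :: 'a) \<noteq> 0" and three: "(3 :: 'a) \<noteq> 0"
    using of_nat_eq_0_iff[of 2] of_nat_eq_0_iff[of 3] assms(3) prime_p
      primes_dvd_imp_eq[of p 2] primes_dvd_imp_eq[of p 3] by auto
  define K :: 'a where "K = of_nat k"
  have K: "3 * K = -2"
    using of_nat_q unfolding q K_def by (simp add: eq_neg_iff_add_eq_0 add.commute)
  have C: "2 * of_nat ((k + 2) choose 2) = (K + 2) * (K + 1)"
  proof -
    have "2 * ((k + 2) choose 2) = (k + 2) * (k + 1)"
      by (simp add: choose_two)
    hence "of_nat (2 * ((k + 2) choose 2)) = (of_nat ((k + 2) * (k + 1)) :: 'a)"
      by (simp only:)
    thus ?thesis
      by (simp add: K_def algebra_simps)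
  qed
  have "(\<Sum>r\<le>2. \<Sum>v\<le>2. term_coeff (k + 2) k r (2 - r) (v + 1) v) = 0"
    using assms k by (intro coefficient_eq_0) auto
  hence "(K + 2) * K * b * conj c + (2 * of_nat ((k + 2) choose 2)) * b * c = 0"
    by (simp add: term_coeff_def K_def numeral_2_eq_2 algebra_simps)
  hence "9 * ((K + 2) * K * b * conj c + (K + 2) * (K + 1) * b * c) = 0"
    unfolding C by simp
  also have "9 * ((K + 2) * K * b * conj c + (K + 2) * (K + 1) * b * c) =
      (3 * K + 6) * (3 * K) * b * conj c + (3 * K + 6) * (3 * K + 3) * b * c"
    by (simp add: algebra_simps)
  also have "\<dots> = 2 * (2 * (b * (c - 2 * conj c)))"
    unfolding K by (simp add: algebra_simps)
  finally have c: "c = conj c + conj c"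
    using b two unfolding mult_eq_0_iff by simp
  hence "conj c = c + c"
    using conj_add[of "conj c" "conj c"] conj_conj[of c] by simp
  with c have "3 * c = 0"
  proof -
    have "c = (c + c) + (c + c)"
      using c \<open>conj c = c + c\<close> by simp
    hence "c + 0 = c + 3 * c"
      by simp
    thus ?thesis
      by (simp only: add_left_cancel)
  qed
  hence "c = 0"
    using three by simp
  with norm_relation[OF assms(1) q k] show False
    using b by (simp add: conj_0)
qed

text \<open>Here the exponents \<open>k + 2\<close> and \<open>k\<close> give a trivial relation,
  all its coefficients being even. Instead \<open>i = k + 3\<close>, \<open>j = k + 1\<close>,
  \<open>R = 5\<close>, \<open>d = 1\<close> are used; modulo \<open>2\<close> only
  \<open>b * c ^ 4\<close> survives.\<close>

lemma b_eq_0_if_p_eq_2: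
  assumes "bij f" and q: "q = 3 * k + 2" and "k > 0" and p: "p = 2"
  shows "b = 0"
proof -
  \<comment> \<open>\<open>q = 2\<close> contradicts \<open>k > 0\<close>, and \<open>4\<close> is
    not \<open>2\<close> modulo \<open>3\<close>.\<close>
  have "e \<noteq> 1" "e \<noteq> 2"
    using q assms(3) p by (auto simp: q_def)
  hence "(8::nat) dvd q"
    using p e_pos le_imp_power_dvd[of 3 e "2::nat"] by (simp add: q_def)
  then obtain m where k: "k = 8 * m + 2"
    using q by (intro that[of "k div 8"]) presburger
  define i j where "i = 8 * m + 5" and "j = 8 * m + 3"
  have of_nat_even: "of_nat n = (0 :: 'a)" if "even n" for n
    using that of_nat_eq_0_iff[of n] p by simp
  have two: "(2 :: 'a) = 0"
    using of_nat_p p by simp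
  \<comment> \<open>This recurrence yields the parities: \<open>i choose 2\<close> and
    \<open>i choose 3\<close> are even, \<open>i choose 4\<close> and \<open>i choose 5\<close> odd,
    \<open>j choose 4\<close> and \<open>j choose 5\<close> even.\<close>
  have step: "Suc n * (l choose Suc n) = (l choose n) * (l - n)" for l n :: nat
    by (metis binomial_absorb_comp binomial_absorption mult.commute)
  have i2: "i choose 2 = (8 * m + 5) * (4 * m + 2)"
    by (simp add: choose_two i_def algebra_simps)
  have "3 * (i choose 3) = (i choose 2) * (i - 2)"
    using step[of 2 i] by simp
  hence i3: "3 * (i choose 3) = (8 * m + 5) * (4 * m + 2) * (8 * m + 3)"
    unfolding i2 by (simp add: i_def)
  have "4 * (i choose 4) = (i choose 3) * (i - 3)"
    using step[of 3 i] by simp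
  hence i4: "2 * (i choose 4) = (i choose 3) * (4 * m + 1)"
    by (simp add: i_def)
  have i5: "5 * (i choose 5) = (i choose 4) * (8 * m + 1)"
    using step[of 4 i] by (simp add: i_def)
  have "3 * (2 * (i choose 4)) = 2 * ((8 * m + 5) * (2 * m + 1) * (8 * m + 3) * (4 * m + 1))"
    unfolding i4 mult.assoc[symmetric] i3 by (simp add: algebra_simps)
  hence "3 * (i choose 4) = (8 * m + 5) * (2 * m + 1) * (8 * m + 3) * (4 * m + 1)"
    by simp
  hence "odd (3 * (i choose 4))"
    by simp
  hence "odd (5 * (i choose 5))"
    unfolding i5 by simp
  hence odd5: "odd (i choose 5)"
    by simp
  have even3: "even (3 * (i choose 3))"
    unfolding i3 by simp
  have j4: "4 * (j choose 4) = (j choose 3) * (8 * m)"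
    using step[of 3 j] by (simp add: j_def)
  hence "even (j choose 4)"
    by simp
  moreover have "5 * (j choose 5) = (j choose 4) * (j - 4)"
    using step[of 4 j] by simp
  hence "even (5 * (j choose 5))"
    using \<open>even (j choose 4)\<close> by simp
  moreover have "even (i choose 2)"
    unfolding i2 by simp
  ultimately have zero: "of_nat (i choose 2) = (0 :: 'a)" "of_nat (i choose 3) = (0 :: 'a)"
      "of_nat (j choose 4) = (0 :: 'a)" "of_nat (j choose 5) = (0 :: 'a)"
    using even3 by (auto intro!: of_nat_even)
  have one: "of_nat (i choose 5) = (1 :: 'a)"
    using odd5 two by (auto elim!: oddE)
  define S where "S r = (\<Sum>v\<le>5. term_coeff i j r (5 - r) (v + 1) v)" for r
  have "sum S {..5} = 0"
    unfolding S_def using assms k by (intro coefficient_eq_0) (auto simp: i_def j_def)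
  moreover have "S r = 0" if "r \<in> {0, 1, 2, 3}" for r
    unfolding S_def using that zero by (intro sum.neutral) (auto simp: term_coeff_def)
  moreover have "S 4 = 0"
    unfolding S_def
  proof (rule sum.neutral, safe)
    fix v :: nat
    have "even (((4::nat) choose (v + 1)) * ((5 - 4) choose v))"
    proof -
      consider "v = 0" | "v = 1" | "v > 1"
        by linarith
      thus ?thesis
        by cases (simp_all add: choose_two binomial_eq_0 numeral_2_eq_2[symmetric])
    qed
    hence "of_nat (((4::nat) choose (v + 1)) * ((5 - 4) choose v)) = (0 :: 'a)"
      by (rule of_nat_even)
    thus "term_coeff i j 4 (5 - 4) (v + 1) v = 0"
      by (auto simp: term_coeff_def)
  qed
  moreover have "S 5 = b * c ^ 4"
  proof -
    have five: "(5 :: 'a) = 1"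
    proof -
      have "(5 :: 'a) = 2 * 2 + 1"
        by simp
      thus ?thesis
        unfolding two by simp
    qed
    have "term_coeff i j 5 (5 - 5) (v + 1) v = (if v = 0 then b * c ^ 4 else 0)" for v
      using one five by (cases v) (simp_all add: term_coeff_def)
    thus ?thesis
      unfolding S_def by simp
  qed
  moreover have "{..5::nat} = {0, 1, 2, 3, 4, 5}"
    by auto
  ultimately have "b * c ^ 4 = 0"
    by simp
  hence "b = 0 \<or> c = 0"
    by simp
  thus ?thesis
    using norm_relation[OF assms(1-3)] by (auto simp: conj_0)
qed

section \<open>The norm map and the case \<open>b = 0\<close>\<close>

text \<open>By counting: the norms lie among at most \<open>q\<close> fixed points of
  \<open>conj\<close>, and each nonzero norm has at most \<open>q + 1\<close> preimages, so
  \<open>q ^ 2\<close> elements need at least \<open>q\<close> norms.\<close>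

lemma norm_surj:
  assumes "conj t = t"
  shows "\<exists>x. x * conj x = t"
proof -
  define I where "I = range (\<lambda>x. x * conj x)"
  have sub: "I \<subseteq> {t. conj t = t}"
    by (auto simp: I_def conj_mult conj_conj mult.commute)
  have "{t. conj t = t} \<subseteq> insert 0 {t. t ^ (q - 1) = 1}"
  proof safe
    fix t :: 'a assume t: "conj t = t" "t \<noteq> 0"
    have "t * t ^ (q - 1) = t"
      using t(1) q_ge_2 by (metis Suc_diff_1 less_le_trans pos2 power_Suc)
    thus "t ^ (q - 1) = 1"
      using t(2) by simp
  qed
  hence "card {t. conj t = t} \<le> card (insert 0 {t :: 'a. t ^ (q - 1) = 1})"
    by (intro card_mono) auto
  also have "\<dots> \<le> Suc (card {t :: 'a. t ^ (q - 1) = 1})"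
    by (rule card_insert_le_m1) auto
  also have "\<dots> \<le> q"
    using card_nth_roots_le[of "q - 1" "1 :: 'a"] q_ge_2 by simp
  finally have F: "card {t. conj t = t} \<le> q" .
  have "UNIV = insert 0 (\<Union>t\<in>I - {0}. {x. x ^ (q + 1) = t})"
    using q_ge_2 by (auto simp: I_def)
  hence "CARD('a) = card (insert 0 (\<Union>t\<in>I - {0}. {x. x ^ (q + 1) = t}))"
    by (rule arg_cong)
  also have "\<dots> \<le> Suc (card (\<Union>t\<in>I - {0}. {x. x ^ (q + 1) = t}))"
    by (rule card_insert_le_m1) auto
  also have "card (\<Union>t\<in>I - {0}. {x. x ^ (q + 1) = t}) \<le> (\<Sum>t\<in>I - {0}. card {x. x ^ (q + 1) = t})"
    by (rule card_UN_le) auto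
  also have "\<dots> \<le> (\<Sum>t\<in>I - {0}. q + 1)"
    by (intro sum_mono card_nth_roots_le) auto
  also have "\<dots> = card (I - {0}) * (q + 1)"
    by simp
  finally have "q * q \<le> Suc (card (I - {0}) * (q + 1))"
    by (simp add: card_q power2_eq_square)
  moreover have "0 \<in> I"
    unfolding I_def by (rule range_eqI[of _ _ 0]) simp
  ultimately have *: "q * q \<le> Suc ((card I - 1) * (q + 1))" "card I > 0"
    by (auto simp: card_gt_0_iff)
  have "q \<le> card I"
  proof (rule ccontr)
    assume "\<not> q \<le> card I"
    hence "(card I - 1) * (q + 1) \<le> (q - 2) * (q + 1)"
      by (intro mult_right_mono) auto
    moreover obtain r where "q = r + 2"
      using q_ge_2 le_Suc_ex by (metis add.commute)
    ultimately show False
      using *(1) by (simp add: algebra_simps)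
  qed
  hence "I = {t. conj t = t}"
    using F sub by (intro card_seteq) auto
  hence "t \<in> I"
    using assms by simp
  thus ?thesis
    unfolding I_def by auto
qed

lemma norm_f:
  assumes "b = 0"
  shows "f x * conj (f x) = (x * conj x) * (x * conj x + c) * (x * conj x + conj c)"
  unfolding conj_f unfolding f_eq using assms
  by (simp add: conj_0 power2_eq_square algebra_simps)

lemma f_eq_if_b_eq_0: "b = 0 \<Longrightarrow> f x = x * (x * conj x + c)"
  unfolding f_eq by (simp add: power2_eq_square algebra_simps)

lemma trace_eq_0_if_p_eq_3:
  assumes "bij f" "b = 0" "p = 3"
  shows "c + conj c = 0"
proof (rule ccontr)
  define s N where "s = c + conj c" and "N = c * conj c"
  \<comment> \<open>With \<open>g t = t ^ 3 + s * t ^ 2 + N * t\<close>, in characteristic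
    \<open>3\<close> the difference \<open>g t - g (t - s)\<close> equals
    \<open>s * (N - t * s)\<close>, which vanishes at \<open>t = h\<close>.\<close>
  define h where "h = N / s"
  assume "c + conj c \<noteq> 0"
  hence s: "s \<noteq> 0"
    by (simp add: s_def)
  have three: "(3 :: 'a) = 0"
    using of_nat_p assms(3) by simp
  have conj: "conj s = s" "conj N = N"
    by (simp_all add: s_def N_def conj_add conj_mult conj_conj mult.commute add.commute)
  hence conj_h: "conj h = h"
    by (simp add: h_def power_divide)
  moreover have "conj (h - s) = h - s"
    using conj_diff[of h s] conj conj_h by simp
  ultimately obtain x y where xy: "x * conj x = h" "y * conj y = h - s"
    using norm_surj by metis
  have "f x * conj (f x) - f y * conj (f y) = 3 * (h ^ 2 * s - h * s ^ 2 + N * s)"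
  proof -
    have N: "N = h * s"
      using s by (simp add: h_def)
    have cubic: "t * (t + c) * (t + conj c) = t ^ 3 + s * t ^ 2 + N * t" for t
      by (simp add: s_def N_def algebra_simps power2_eq_square power3_eq_cube)
    show ?thesis
      unfolding norm_f[OF assms(2)] xy cubic N
      by (simp add: algebra_simps power2_eq_square power3_eq_cube)
  qed
  hence norm_eq: "f x * conj (f x) = f y * conj (f y)"
    unfolding three by simp
  have inj: "inj f"
    using assms(1) by (rule bij_is_inj)
  have xy_eq: "x * conj x = y * conj y"
  proof (cases "f y = 0")
    case True
    hence "f x = f y"
      using norm_eq by auto
    thus ?thesis
      using inj by (metis injD)
  next
    case False
    \<comment> \<open>An element \<open>v\<close> of norm \<open>1\<close> satisfies
      \<open>f (v * y) = v * f y\<close>, so equal norms of values lift to the collision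
      \<open>f (v * y) = f x\<close>.\<close>
    define v where "v = f x / f y"
    have v: "v * conj v = 1"
      using norm_eq False by (simp add: v_def power_divide)
    have "(v * y) * conj (v * y) = (v * conj v) * (y * conj y)"
      by (simp only: conj_mult mult_ac)
    hence n: "(v * y) * conj (v * y) = y * conj y"
      by (simp add: v)
    have "f (v * y) = v * f y"
      unfolding f_eq_if_b_eq_0[OF assms(2)] n by (simp add: mult_ac)
    hence "f (v * y) = f x"
      using False by (simp add: v_def)
    hence "x = v * y"
      using inj by (metis injD)
    thus ?thesis
      using n by simp
  qed
  thus False
    using xy s by simp
qed

text \<open>On the fixed field of \<open>conj\<close>, cubing is inverted by the power
  \<open>2 * k + 1\<close>, since \<open>3 * (2 * k + 1) = 2 * q - 1\<close>.\<close>

lemma cube_inj: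
  assumes "q mod 3 = 2" "conj s = s" "conj t = t" "s ^ 3 = t ^ 3"
  shows "s = t"
proof -
  define k where "k = q div 3"
  have q: "q = 3 * k + 2"
    using assms(1) by (simp add: k_def) presburger
  have "(u ^ 3) ^ (2 * k + 1) = u" if u: "conj u = u" for u
  proof -
    have "(u ^ 3) ^ (2 * k + 1) = u ^ (q + (3 * k + 1))"
      unfolding power_mult[symmetric] by (rule arg_cong[of _ _ "power u"]) (simp add: q)
    also have "\<dots> = u ^ Suc (3 * k + 1)"
      by (simp only: power_add u power_Suc)
    also have "Suc (3 * k + 1) = q"
      by (simp add: q)
    finally show ?thesis
      using u by simp
  qed
  thus ?thesis
    using assms by metis
qed

lemma bij_if_b_eq_0:
  assumes "b = 0" "q mod 3 \<noteq> 1" and rel: "c ^ 2 + conj c ^ 2 = c * conj c"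
  shows "bij f"
proof -
  define s N where "s = c + conj c" and "N = c * conj c"
  have s2: "s ^ 2 = 3 * N"
    using rel by (simp add: s_def N_def power2_eq_square algebra_simps)
  have conj_s: "conj s = s"
    by (simp add: s_def conj_add conj_conj add.commute)
  have cubic: "t * (t + c) * (t + conj c) = t ^ 3 + s * t ^ 2 + N * t" for t
    by (simp add: s_def N_def algebra_simps power2_eq_square power3_eq_cube)
  \<comment> \<open>For \<open>conj c = c\<close> the relation reads
    \<open>c ^ 2 + c ^ 2 = c ^ 2\<close>.\<close>
  have c0: "c = 0" if "conj c = c"
    using rel unfolding that power2_eq_square by (metis add_cancel_right_right mult_eq_0_iff)
  have g_inj: "t = u" if tu: "conj t = t" "conj u = u"
      "t * (t + c) * (t + conj c) = u * (u + c) * (u + conj c)" for t u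
  proof (cases "p = 3")
    case True
    hence three: "(3 :: 'a) = 0"
      using of_nat_p by simp
    hence s: "s = 0"
      using s2 by simp
    hence conj_c: "conj c = - c"
      by (simp add: s_def eq_neg_iff_add_eq_0 add.commute)
    have N: "N = - (c ^ 2)"
      by (simp add: N_def conj_c power2_eq_square)
    \<comment> \<open>The cubic is now additive with roots \<open>0\<close>, \<open>c\<close> and
      \<open>- c\<close>; as \<open>conj c = - c\<close>, a nonzero root is not fixed by
      \<open>conj\<close>.\<close>
    have "(t - u) * ((t - u) - c) * ((t - u) + c) = (t - u) ^ 3 - c ^ 2 * (t - u)"
      by (simp add: algebra_simps power2_eq_square power3_eq_cube)
    also have "\<dots> = (t ^ 3 + N * t) - (u ^ 3 + N * u) - 3 * (t ^ 2 * u - t * u ^ 2)"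
      by (simp add: N algebra_simps power2_eq_square power3_eq_cube)
    also have "\<dots> = 0"
      using tu(3) unfolding cubic s three by simp
    finally have "t - u = 0 \<or> t - u = c \<or> t - u = - c"
      by (auto simp: eq_neg_iff_add_eq_0)
    moreover have "conj (t - u) = t - u"
      using conj_diff[of t u] tu by simp
    ultimately have "t - u = 0 \<or> conj c = c"
      using conj_c conj_diff[of 0 c] by (auto simp: conj_0)
    thus ?thesis
      using c0 \<open>t - u = 0 \<or> t - u = c \<or> t - u = - c\<close> by auto
  next
    case False
    have "\<not> 3 dvd q"
    proof
      assume "3 dvd q"
      hence "3 dvd p"
        unfolding q_def by (rule prime_dvd_power[rotated]) simp
      thus False
        using False prime_p primes_dvd_imp_eq[of 3 p] by simp
    qed
    hence q3: "q mod 3 = 2"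
      using assms(2) by presburger
    have three: "(3 :: 'a) \<noteq> 0"
      using of_nat_eq_0_iff[of 3] prime_p False primes_dvd_imp_eq[of p 3] by auto
    have conj3: "conj (3 * v + s) = 3 * v + s" if "conj v = v" for v
    proof -
      have "3 * v + s = v + v + v + s"
        by simp
      thus ?thesis
        using that conj_s by (metis conj_add)
    qed
    \<comment> \<open>Completing the cube; \<open>s ^ 2 = 3 * N\<close> makes the linear terms
      agree.\<close>
    have cube: "(3 * v + s) ^ 3 = 27 * (v * (v + c) * (v + conj c)) + s ^ 3" for v
    proof -
      have "(3 * v + s) ^ 3 = 27 * v ^ 3 + 27 * s * v ^ 2 + 9 * v * s ^ 2 + s ^ 3"
        by (simp add: algebra_simps power2_eq_square power3_eq_cube)
      thus ?thesis
        unfolding s2 cubic by (simp add: algebra_simps)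
    qed
    have "3 * t + s = 3 * u + s"
      by (rule cube_inj[OF q3]) (use tu conj3 cube in auto)
    thus ?thesis
      using three by simp
  qed
  have "inj f"
  proof
    fix x y assume xy: "f x = f y"
    have eq: "x * conj x = y * conj y"
    proof (rule g_inj)
      show "(x * conj x) * (x * conj x + c) * (x * conj x + conj c) =
          (y * conj y) * (y * conj y + c) * (y * conj y + conj c)"
        using xy norm_f[OF assms(1)] by metis
    qed (simp_all add: conj_mult conj_conj mult.commute)
    show "x = y"
    \<comment> \<open>Equal norms give \<open>f x\<close> and \<open>f y\<close> the same cofactor,
      which can be cancelled unless it is zero; in that case \<open>c\<close> is fixed by
      \<open>conj\<close>, hence zero, and so are both norms.\<close>
    proof (cases "x * conj x + c = 0")
      case True
      hence "c = - (x * conj x)"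
        by (simp add: eq_neg_iff_add_eq_0 add.commute)
      moreover have "conj (- (x * conj x)) = - (x * conj x)"
        using conj_diff[of 0 "x * conj x"]
        by (simp add: conj_0 conj_mult conj_conj mult.commute)
      ultimately have "c = 0"
        using c0 by simp
      thus ?thesis
        using True eq by auto
    next
      case False
      thus ?thesis
        using xy unfolding f_eq_if_b_eq_0[OF assms(1)] eq by simp
    qed
  qed
  thus ?thesis
    by (simp add: bij_betw_def finite_UNIV_inj_surj)
qed

section \<open>The root condition, the case \<open>q = 2\<close> and the equivalence\<close>

text \<open>With \<open>u = c ^ (q - 1)\<close> one has \<open>conj c = c * u\<close>; for
  \<open>c \<noteq> 0\<close> both sides reduce to \<open>u ^ 2 - u + 1 = 0\<close>.\<close>

lemma root_iff:
  "(c ^ (q - 1)) ^ 3 - (c ^ (q - 1)) ^ 2 + c ^ (q - 1) = 0 \<longleftrightarrow> c ^ 2 + conj c ^ 2 = c * conj c"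
proof (cases "c = 0")
  case True
  thus ?thesis
    using q_ge_2 by (simp add: power_0_left)
next
  case False
  define u where "u = c ^ (q - 1)"
  have conj: "conj c = c * u"
    unfolding u_def using q_ge_2 by (metis Suc_diff_1 less_le_trans pos2 power_Suc)
  have "u \<noteq> 0"
    using False by (simp add: u_def)
  have "u ^ 3 - u ^ 2 + u = 0 \<longleftrightarrow> u * (u ^ 2 - u + 1) = 0"
    by (simp add: algebra_simps power2_eq_square power3_eq_cube)
  also have "\<dots> \<longleftrightarrow> c ^ 2 * (u ^ 2 - u + 1) = 0"
    using False \<open>u \<noteq> 0\<close> by simp
  also have "c ^ 2 * (u ^ 2 - u + 1) = c ^ 2 + conj c ^ 2 - c * conj c"
    unfolding conj by (simp add: algebra_simps power2_eq_square)
  finally show ?thesis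
    unfolding u_def by simp
qed

lemma
  assumes "q = 2"
  shows two_eq_0: "(2 :: 'a) = 0"
    and power_4: "x ^ 4 = (x :: 'a)"
    and f_eq_if_q_eq_2: "f x = (1 + c) * x + b * x ^ 2"
proof -
  have "p dvd 2"
    using assms e_pos unfolding q_def by (metis dvd_power less_le_trans zero_less_one)
  hence "of_nat 2 = (0 :: 'a)"
    unfolding of_nat_eq_0_iff .
  thus "(2 :: 'a) = 0"
    by simp
  have "(x ^ 2) ^ 2 = x"
    using conj_conj[of x] unfolding assms .
  thus four: "x ^ 4 = x"
    by (simp flip: power_mult)
  show "f x = (1 + c) * x + b * x ^ 2"
    unfolding f_def unfolding assms by (simp add: four algebra_simps)
qed

lemma bij_iff_if_q_eq_2:
  assumes "q = 2" "b \<noteq> 0"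
  shows "bij f \<longleftrightarrow> c = 1"
proof -
  note two = two_eq_0[OF assms(1)] and four = power_4[OF assms(1)]
    and f = f_eq_if_q_eq_2[OF assms(1)]
  show ?thesis
  proof
    assume "bij f"
    hence inj: "inj f"
      by (rule bij_is_inj)
    \<comment> \<open>The second root of \<open>f x = x * ((1 + c) + b * x)\<close>.\<close>
    have "f (- (1 + c) / b) = f 0"
      unfolding f using assms(2) by (simp add: field_simps power2_eq_square)
    hence "- (1 + c) / b = 0"
      using inj by (metis injD)
    hence "c = - 1"
      using assms(2) by (simp add: eq_neg_iff_add_eq_0 add.commute)
    also have "- 1 = 1 - (2 :: 'a)"
      by simp
    finally show "c = 1"
      using two by simp
  next
    assume c: "c = 1"
    have f': "f x = b * x ^ 2" for x
      unfolding f using two by (simp add: c)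
    have "inj f"
    proof
      fix x y assume "f x = f y"
      hence "x ^ 2 = y ^ 2"
        unfolding f' using assms(2) by simp
      hence "(x ^ 2) ^ 2 = (y ^ 2) ^ 2"
        by (rule arg_cong)
      thus "x = y"
        by (simp add: four flip: power_mult)
    qed
    thus "bij f"
      by (simp add: bij_betw_def finite_UNIV_inj_surj)
  qed
qed

lemma necessary_if_q_ne_2:
  assumes "bij f" "q \<noteq> 2"
  shows "q mod 3 \<noteq> 1 \<and> b = 0 \<and> c ^ 2 + conj c ^ 2 = c * conj c"
proof (cases "q mod 3 = 2")
  case True
  define k where "k = q div 3"
  have q: "q = 3 * k + 2"
    using True by (simp add: k_def) presburger
  have k: "k > 0"
    using q assms(2) by auto
  have b: "b = 0"
    using b_eq_0_if_p_odd[OF assms(1) q] b_eq_0_if_p_eq_2[OF assms(1) q k] by blast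
  thus ?thesis
    using norm_relation[OF assms(1) q k] True by simp
next
  case False
  have mod: "q mod 3 \<noteq> 1"
    using assms(1) not_bij_if_mod_3_eq_1 by blast
  with False have "3 dvd q"
    by presburger
  hence "3 dvd p"
    unfolding q_def by (rule prime_dvd_power[rotated]) simp
  hence p: "p = 3"
    using prime_p primes_dvd_imp_eq[of 3 p] by simp
  have b: "b = 0"
    using assms(1) p by (rule b_eq_0_if_p_eq_3)
  have "conj c = - c"
    using trace_eq_0_if_p_eq_3[OF assms(1) b p] by (simp add: eq_neg_iff_add_eq_0 add.commute)
  \<comment> \<open>With \<open>conj c = - c\<close> the relation becomes
    \<open>3 * c ^ 2 = 0\<close>.\<close>
  moreover have "(3 :: 'a) = 0"
    using of_nat_p p by simp
  hence "3 * c ^ 2 = 0"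
    by simp
  hence "c ^ 2 + c ^ 2 = c * - c"
    by (simp add: eq_neg_iff_add_eq_0 power2_eq_square)
  ultimately show ?thesis
    using b mod by simp
qed

lemma bij_f_iff:
  "bij f \<longleftrightarrow>
    ((q mod 3 \<noteq> 1 \<and> b = 0 \<and>
        (c ^ (q - 1)) ^ 3 - (c ^ (q - 1)) ^ 2 + c ^ (q - 1) = 0)
     \<or> (q = 2 \<and> b \<noteq> 0 \<and> c = 1))"
proof (cases "q = 2 \<and> b \<noteq> 0")
  case True
  thus ?thesis
    using bij_iff_if_q_eq_2 by simp
next
  case False
  have "q mod 3 \<noteq> 1 \<and> b = 0 \<and> c ^ 2 + conj c ^ 2 = c * conj c" if bij: "bij f"
  proof (cases "q = 2")
    case False
    thus ?thesis
      using necessary_if_q_ne_2[OF bij] by simp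
  next
    case True
    with False have b: "b = 0"
      by simp
    note two = two_eq_0[OF True] and four = power_4[OF True]
    \<comment> \<open>For \<open>q = 2\<close> and \<open>b = 0\<close> the map is
      \<open>x \<mapsto> (1 + c) * x\<close>, so injectivity gives \<open>c + 1 \<noteq> 0\<close>,
      a factor that can be cancelled below.\<close>
    have "f 1 \<noteq> f 0"
      using bij_is_inj[OF bij] by (metis injD one_neq_zero)
    hence "c + 1 \<noteq> 0"
      unfolding f_eq_if_q_eq_2[OF True] using b by (simp add: add.commute)
    moreover have "(c + 1) * (c ^ 2 + conj c ^ 2 - c * conj c) = (c ^ 4 - c) * c + 2 * c ^ 2"
      unfolding True by (simp add: algebra_simps power2_eq_square power4_eq_xxxx)
    hence "(c + 1) * (c ^ 2 + conj c ^ 2 - c * conj c) = 0"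
      by (simp add: two four)
    ultimately show ?thesis
      using b True by simp
  qed
  thus ?thesis
    unfolding root_iff using False bij_if_b_eq_0 by blast
qed

end

theorem theorem1p3:
  fixes q :: nat and b c :: "'a::{field, finite}"
  assumes "\<exists>p k. prime p \<and> k \<ge> 1 \<and> q = p ^ k"
    and "CARD('a) = q ^ 2"
  shows "bij (\<lambda>x::'a. x ^ (q + 2) + b * x ^ q + c * x) \<longleftrightarrow>
    ((q mod 3 \<noteq> 1 \<and> b = 0 \<and>
        (c ^ (q - 1)) ^ 3 - (c ^ (q - 1)) ^ 2 + c ^ (q - 1) = 0)
     \<or> (q = 2 \<and> b \<noteq> 0 \<and> c = 1))"
proof -
  obtain p e where "prime p" "e \<ge> 1" "q = p ^ e"
    using assms(1) by blast
  then interpret permutation_trinomial p e q b c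
    using assms(2) by unfold_locales
  have "f = (\<lambda>x. x ^ (q + 2) + b * x ^ q + c * x)"
    by (rule ext) (rule f_def)
  thus ?thesis
    using bij_f_iff by simp
qed

end
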